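(* Let $(\mathcal{A},\mathfrak{g})$ be a Lie pair and let $(M,h)$ be a regular hermitian right $\mathcal{A}$-module. Then there exists a hermitian connection on $(M,h)$.
   Context: A Lie pair $(\mathcal{A},\mathfrak{g})$ consists of a unital $*$-algebra $\mathcal{A}$ over $\mathbb{C}$ and a (complex) Lie algebra $\mathfrak{g}$ of derivations of $\mathcal{A}$ that is $*$-closed: $\partial^*\in\mathfrak{g}$ for all $\partial\in\mathfrak{g}$, where $\partial^*(f)=(\partial(f^* ))^*$. A hermitian form on a right $\mathcal{A}$-module $M$ is a map $h:M\times M\to\mathcal{A}$ with $h(m_1,m_2)^*=h(m_2,m_1)$, $h(m_1,m_2a)=h(m_1,m_2)a$ and $h(m_1+m_2,m)=h(m_1,m)+h(m_2,m)$. With $M^*$ the dual module of right $\mathcal{A}$-module homomorphisms $M\to\mathcal{A}$ and $\hat h:M\to M^*$, $\hat h(m_1)(m_2)=h(m_1,m_2)$, the form $h$ is invertible if $\hat h$ is a bijection. $(M,h)$ is a regular hermitian module if $M$ is finitely generated projective and $h$ is an invertible hermitian form on $M$. A connection on $M$ is a map $\nabla:\mathfrak{g}\times M\to M$ such that $\nabla_\partial(m_1+m_2)=\nabla_\partial m_1+\nabla_\partial m_2$, $\nabla_{\lambda_1\partial_1+\lambda_2\partial_2}m=\lambda_1\nabla_{\partial_1}m+\lambda_2\nabla_{\partial_2}m$ and $\nabla_\partial(ma)=(\nabla_\partial m)a+m\,\partial(a)$ for $m,m_1,m_2\in M$, $\partial,\partial_1,\partial_2\in\mathfrak{g}$, $\lambda_1,\lambda_2\in\mathbb{C}$,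 $a\in\mathcal{A}$. It is hermitian on $(M,h)$ if $\partial h(m_1,m_2)=h(\nabla_{\partial^*}m_1,m_2)+h(m_1,\nabla_\partial m_2)$ for all $m_1,m_2\in M$, $\partial\in\mathfrak{g}$. *)

theory Defs
  imports Complex_Main "HOL-Library.Poly_Mapping"
begin

text \<open>
  The sort \<open>{ring, monoid_mult}\<close> is that of unital, possibly noncommutative rings; unlike
  \<open>ring_1\<close> it does not exclude the zero ring.
\<close>

locale complex_star_algebra = vector_space scale
  for scale :: "complex \<Rightarrow> 'a::{ring, monoid_mult} \<Rightarrow> 'a" +
  fixes star :: "'a \<Rightarrow> 'a"
  assumes scale_mult_left: "scale c a * b = scale c (a * b)"
    and scale_mult_right: "a * scale c b = scale c (a * b)"
    and star_add: "star (a + b) = star a + star b"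
    and star_scale: "star (scale c a) = scale (cnj c) (star a)"
    and star_mult: "star (a * b) = star b * star a"
    and star_star: "star (star a) = a"

definition derivation :: "(complex \<Rightarrow> 'a \<Rightarrow> 'a) \<Rightarrow> ('a::{ring, monoid_mult} \<Rightarrow> 'a) \<Rightarrow> bool" where
  "derivation scale d \<longleftrightarrow>
     Vector_Spaces.linear scale scale d \<and> (\<forall>a b. d (a * b) = d a * b + a * d b)"

definition star_deriv :: "('a \<Rightarrow> 'a) \<Rightarrow> ('a \<Rightarrow> 'a) \<Rightarrow> 'a \<Rightarrow> 'a" where
  "star_deriv star d = (\<lambda>f. star (d (star f)))"

locale lie_pair = complex_star_algebra scale star
  for scale :: "complex \<Rightarrow> 'a::{ring, monoid_mult} \<Rightarrow> 'a" and star :: "'a \<Rightarrow> 'a" +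
  fixes \<gg> :: "('a \<Rightarrow> 'a) set"
  assumes derivations: "d \<in> \<gg> \<Longrightarrow> derivation scale d"
    and zero_closed: "(\<lambda>f. 0) \<in> \<gg>"
    and add_closed: "\<lbrakk>d \<in> \<gg>; e \<in> \<gg>\<rbrakk> \<Longrightarrow> (\<lambda>f. d f + e f) \<in> \<gg>"
    and scale_closed: "d \<in> \<gg> \<Longrightarrow> (\<lambda>f. scale c (d f)) \<in> \<gg>"
    and bracket_closed: "\<lbrakk>d \<in> \<gg>; e \<in> \<gg>\<rbrakk> \<Longrightarrow> (\<lambda>f. d (e f) - e (d f)) \<in> \<gg>"
    and star_closed: "d \<in> \<gg> \<Longrightarrow> star_deriv star d \<in> \<gg>"

locale right_module =
  fixes act :: "'m::ab_group_add \<Rightarrow> 'a::{ring, monoid_mult} \<Rightarrow> 'm"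
  assumes act_add_left: "act (m + n) a = act m a + act n a"
    and act_add_right: "act m (a + b) = act m a + act m b"
    and act_mult: "act m (a * b) = act (act m a) b"
    and act_one: "act m 1 = m"

definition right_module_hom ::
    "('m::ab_group_add \<Rightarrow> 'a \<Rightarrow> 'm) \<Rightarrow> ('n::ab_group_add \<Rightarrow> 'a \<Rightarrow> 'n) \<Rightarrow> ('m \<Rightarrow> 'n) \<Rightarrow> bool" where
  "right_module_hom act act' f \<longleftrightarrow>
     (\<forall>m n. f (m + n) = f m + f n) \<and> (\<forall>m a. f (act m a) = act' (f m) a)"

definition right_submodule :: "('m::ab_group_add \<Rightarrow> 'a \<Rightarrow> 'm) \<Rightarrow> 'm set \<Rightarrow> bool" where
  "right_submodule act P \<longleftrightarrow>
     0 \<in> P \<and> (\<forall>p\<in>P. \<forall>q\<in>P. p + q \<in> P) \<and> (\<forall>p\<in>P. \<forall>a. act p a \<in> P)"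

definition finitely_generated ::
    "('m::ab_group_add \<Rightarrow> 'a::{ring, monoid_mult} \<Rightarrow> 'm) \<Rightarrow> bool" where
  "finitely_generated act \<longleftrightarrow>
     (\<exists>S. finite S \<and> (\<forall>m. \<exists>c. m = (\<Sum>s\<in>S. act s (c s))))"

text \<open>The free right module on an index type: finitely supported functions, acted on pointwise.\<close>

definition free_act :: "('i \<Rightarrow>\<^sub>0 'a) \<Rightarrow> 'a::{ring, monoid_mult} \<Rightarrow> ('i \<Rightarrow>\<^sub>0 'a)" where
  "free_act f a = Poly_Mapping.map (\<lambda>x. x * a) f"

text \<open>
  Projective: isomorphic to a direct summand of a free module. HOL cannot quantify over the index
  type of the free module inside a definition; the underlying type of \<open>M\<close> is used. This loses no
  generality: a direct summand of any free module is projective, so the canonical surjection onto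
  \<open>M\<close> from the free module on the elements of \<open>M\<close> splits.
\<close>

definition projective ::
    "('m::ab_group_add \<Rightarrow> 'a::{ring, monoid_mult} \<Rightarrow> 'm) \<Rightarrow> bool" where
  "projective act \<longleftrightarrow>
     (\<exists>(P :: ('m \<Rightarrow>\<^sub>0 'a) set) Q \<phi>.
        right_submodule free_act P \<and> right_submodule free_act Q \<and>
        P \<inter> Q = {0} \<and> (\<forall>f. \<exists>p\<in>P. \<exists>q\<in>Q. f = p + q) \<and>
        right_module_hom act free_act \<phi> \<and> bij_betw \<phi> UNIV P)"

definition dual_module ::
    "('m::ab_group_add \<Rightarrow> 'a::{ring, monoid_mult} \<Rightarrow> 'm) \<Rightarrow> ('m \<Rightarrow> 'a) set" where
  "dual_module act = {\<omega>. right_module_hom act (*) \<omega>}"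

definition hermitian_form ::
    "('a \<Rightarrow> 'a) \<Rightarrow> ('m::ab_group_add \<Rightarrow> 'a::{ring, monoid_mult} \<Rightarrow> 'm) \<Rightarrow> ('m \<Rightarrow> 'm \<Rightarrow> 'a) \<Rightarrow> bool" where
  "hermitian_form star act h \<longleftrightarrow>
     (\<forall>m n. star (h m n) = h n m) \<and>
     (\<forall>m n a. h m (act n a) = h m n * a) \<and>
     (\<forall>m n k. h (m + n) k = h m k + h n k)"

text \<open>As \<open>h\<close> is curried, \<open>h\<close> itself is the map \<open>m \<mapsto> h(m, -)\<close> from \<open>M\<close> to its dual.\<close>

definition invertible_form ::
    "('m::ab_group_add \<Rightarrow> 'a::{ring, monoid_mult} \<Rightarrow> 'm) \<Rightarrow> ('m \<Rightarrow> 'm \<Rightarrow> 'a) \<Rightarrow> bool" where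
  "invertible_form act h \<longleftrightarrow> bij_betw h UNIV (dual_module act)"

definition regular_hermitian_module ::
    "('a \<Rightarrow> 'a) \<Rightarrow> ('m::ab_group_add \<Rightarrow> 'a::{ring, monoid_mult} \<Rightarrow> 'm) \<Rightarrow> ('m \<Rightarrow> 'm \<Rightarrow> 'a) \<Rightarrow> bool" where
  "regular_hermitian_module star act h \<longleftrightarrow>
     right_module act \<and> finitely_generated act \<and> projective act \<and>
     hermitian_form star act h \<and> invertible_form act h"

text \<open>The complex scalars act on a right module through the unit of the algebra.\<close>

definition module_scale ::
    "(complex \<Rightarrow> 'a \<Rightarrow> 'a) \<Rightarrow> ('m::ab_group_add \<Rightarrow> 'a::{ring, monoid_mult} \<Rightarrow> 'm) \<Rightarrow> complex \<Rightarrow> 'm \<Rightarrow> 'm" where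
  "module_scale scale act c m = act m (scale c 1)"

text \<open>A connection is constrained only on \<open>\<gg>\<close>; its values at other functions are irrelevant.\<close>

definition connection ::
    "(complex \<Rightarrow> 'a \<Rightarrow> 'a) \<Rightarrow> ('a \<Rightarrow> 'a) set \<Rightarrow> ('m::ab_group_add \<Rightarrow> 'a::{ring, monoid_mult} \<Rightarrow> 'm) \<Rightarrow>
     (('a \<Rightarrow> 'a) \<Rightarrow> 'm \<Rightarrow> 'm) \<Rightarrow> bool" where
  "connection scale \<gg> act nabla \<longleftrightarrow>
     (\<forall>d\<in>\<gg>. \<forall>m n. nabla d (m + n) = nabla d m + nabla d n) \<and>
     (\<forall>d\<in>\<gg>. \<forall>e\<in>\<gg>. \<forall>c c' m.
        nabla (\<lambda>f. scale c (d f) + scale c' (e f)) m =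
        module_scale scale act c (nabla d m) + module_scale scale act c' (nabla e m)) \<and>
     (\<forall>d\<in>\<gg>. \<forall>m a. nabla d (act m a) = act (nabla d m) a + act m (d a))"

definition hermitian_connection ::
    "(complex \<Rightarrow> 'a \<Rightarrow> 'a) \<Rightarrow> ('a \<Rightarrow> 'a) \<Rightarrow> ('a \<Rightarrow> 'a) set \<Rightarrow>
     ('m::ab_group_add \<Rightarrow> 'a::{ring, monoid_mult} \<Rightarrow> 'm) \<Rightarrow> ('m \<Rightarrow> 'm \<Rightarrow> 'a) \<Rightarrow>
     (('a \<Rightarrow> 'a) \<Rightarrow> 'm \<Rightarrow> 'm) \<Rightarrow> bool" where
  "hermitian_connection scale star \<gg> act h nabla \<longleftrightarrow>
     connection scale \<gg> act nabla \<and>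
     (\<forall>d\<in>\<gg>. \<forall>m n. d (h m n) = h (nabla (star_deriv star d) m) n + h m (nabla d n))"

end

theory Submission
  imports Defs
begin

text \<open>
  Writing \<open>M\<close> as a retract of a free module, coordinatewise differentiation of the free module
  followed by the retraction is a connection \<open>\<nabla>\<close> on \<open>M\<close>. As \<open>h\<close> is invertible, \<open>\<nabla>\<close> has an adjoint
  \<open>\<nabla>'\<close> determined by \<open>h (\<nabla>'\<^sub>\<partial> m) n = \<partial>\<^sup>* (h m n) - h m (\<nabla>\<^bsub>\<partial>\<^sup>*\<^esub> n)\<close>, which is again a connection, and
  the mean of \<open>\<nabla>\<close> and \<open>\<nabla>'\<close> is hermitian.
\<close>

section \<open>Free modules, direct summands and retracts\<close>

lemma lookup_free_act [simp]:
  "Poly_Mapping.lookup (free_act f a) i = Poly_Mapping.lookup f i * a"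
  by (simp add: free_act_def map.rep_eq when_def)

lemma right_module_free_act: "right_module free_act"
  by unfold_locales
    (auto intro!: poly_mapping_eqI simp: lookup_add distrib_left distrib_right mult.assoc)

context right_module
begin

lemma act_zero [simp]: "act m 0 = 0"
  using act_add_right[of m 0 0] by simp

lemma act_uminus: "act m (- a) = - act m a"
  using act_add_right[of m a "- a"] by (simp add: eq_neg_iff_add_eq_0 add.commute)

text \<open>\<open>right_submodule\<close> does not mention negatives; they come from acting with
  \<open>- 1\<close>.\<close>

lemma right_submodule_diff:
  assumes "right_submodule act P" "p \<in> P" "q \<in> P"
  shows "p - q \<in> P"
proof -
  have "act q (- 1) \<in> P"
    using assms by (auto simp: right_submodule_def)
  then have "- q \<in> P"
    by (simp add: act_uminus act_one)
  then have "p + - q \<in> P"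
    using assms by (auto simp: right_submodule_def simp del: add_uminus_conv_diff)
  then show ?thesis
    by simp
qed

text \<open>Since \<open>P\<close> and \<open>Q\<close> meet only in 0, the
  \<open>P\<close>-component of an element is unique. Hence choosing it for each element gives a map
  that is automatically a module homomorphism.\<close>

lemma direct_summand_projection:
  assumes P: "right_submodule act P" and Q: "right_submodule act Q"
    and disj: "P \<inter> Q = {0}" and span: "\<forall>f. \<exists>p\<in>P. \<exists>q\<in>Q. f = p + q"
  obtains \<pi> where "right_module_hom act act \<pi>" "range \<pi> \<subseteq> P" "\<And>p. p \<in> P \<Longrightarrow> \<pi> p = p"
proof -
  have "\<forall>f. \<exists>p. p \<in> P \<and> f - p \<in> Q"
    using span by (metis add_diff_cancel_left')
  then obtain \<pi> where \<pi>: "\<pi> f \<in> P" "f - \<pi> f \<in> Q" for f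
    by metis
  \<comment> \<open>Two \<open>P\<close>-components of \<open>f\<close> differ by an element of both
    \<open>P\<close> and \<open>Q\<close>. Each law for \<open>\<pi>\<close> below is then proved by
    exhibiting a candidate component.\<close>
  have unique: "\<pi> f = p" if "p \<in> P" "f - p \<in> Q" for f p
  proof -
    have "\<pi> f - p \<in> P"
      using right_submodule_diff[OF P] \<pi> that by blast
    moreover have "(f - p) - (f - \<pi> f) \<in> Q"
      using right_submodule_diff[OF Q] \<pi> that by blast
    ultimately have "\<pi> f - p \<in> P \<inter> Q"
      by simp
    then show ?thesis
      unfolding disj by simp
  qed
  have "\<pi> (f + g) = \<pi> f + \<pi> g" for f g
  proof (rule unique)
    show "\<pi> f + \<pi> g \<in> P"
      using P \<pi> by (auto simp: right_submodule_def)
    have "(f - \<pi> f) + (g - \<pi> g) \<in> Q"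
      using Q \<pi> by (auto simp: right_submodule_def)
    then show "f + g - (\<pi> f + \<pi> g) \<in> Q"
      by (simp add: algebra_simps)
  qed
  moreover have "\<pi> (act f a) = act (\<pi> f) a" for f a
  proof (rule unique)
    show "act (\<pi> f) a \<in> P"
      using P \<pi> by (auto simp: right_submodule_def)
    have "act (f - \<pi> f) a \<in> Q"
      using Q \<pi> by (auto simp: right_submodule_def)
    moreover have "act f a = act (f - \<pi> f) a + act (\<pi> f) a"
      by (simp flip: act_add_left)
    ultimately show "act f a - act (\<pi> f) a \<in> Q"
      by simp
  qed
  moreover have "\<pi> p = p" if "p \<in> P" for p
    using that Q by (intro unique) (auto simp: right_submodule_def)
  ultimately show ?thesis
    using \<pi>(1) that[of \<pi>] by (simp add: right_module_hom_def image_subset_iff)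
qed

end

text \<open>The retraction \<open>\<psi>\<close> is the projection onto the summand followed by the
  inverse of the isomorphism \<open>\<phi>\<close> onto it.\<close>

lemma projective_retract_of_free:
  fixes act :: "'m::ab_group_add \<Rightarrow> 'a::{ring, monoid_mult} \<Rightarrow> 'm"
  assumes "projective act"
  obtains \<phi> :: "'m \<Rightarrow> ('m \<Rightarrow>\<^sub>0 'a)" and \<psi>
  where "right_module_hom act free_act \<phi>" "right_module_hom free_act act \<psi>" "\<And>m. \<psi> (\<phi> m) = m"
proof -
  obtain P Q :: "('m \<Rightarrow>\<^sub>0 'a) set" and \<phi> where
    P: "right_submodule free_act P" and Q: "right_submodule free_act Q"
    and disj: "P \<inter> Q = {0}" and span: "\<forall>f. \<exists>p\<in>P. \<exists>q\<in>Q. f = p + q"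
    and \<phi>: "right_module_hom act free_act \<phi>" and bij: "bij_betw \<phi> UNIV P"
    using assms unfolding projective_def by blast
  obtain \<pi> where \<pi>: "right_module_hom free_act free_act \<pi>" "range \<pi> \<subseteq> P"
    "\<And>p. p \<in> P \<Longrightarrow> \<pi> p = p"
    using right_module.direct_summand_projection[OF right_module_free_act P Q disj span] by blast
  define \<psi> where "\<psi> f = inv \<phi> (\<pi> f)" for f
  have inj: "inj \<phi>" and range: "range \<phi> = P"
    using bij by (auto simp: bij_betw_def)
  have \<phi>\<psi>: "\<phi> (\<psi> f) = \<pi> f" for f
    using \<pi>(2) range by (auto simp: \<psi>_def intro!: f_inv_into_f)
  \<comment> \<open>Injectivity of \<open>\<phi>\<close> transfers the homomorphism laws from
    \<open>\<pi>\<close> to \<open>\<psi>\<close>.\<close>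
  have "\<psi> (f + g) = \<psi> f + \<psi> g" for f g
    by (rule injD[OF inj]) (use \<phi> \<pi>(1) in \<open>simp add: \<phi>\<psi> right_module_hom_def\<close>)
  moreover have "\<psi> (free_act f a) = act (\<psi> f) a" for f a
    by (rule injD[OF inj]) (use \<phi> \<pi>(1) in \<open>simp add: \<phi>\<psi> right_module_hom_def\<close>)
  moreover have "\<psi> (\<phi> m) = m" for m
    using \<pi>(3) range inj by (auto simp: \<psi>_def)
  ultimately show ?thesis
    using that[OF \<phi>, of \<psi>] by (simp add: right_module_hom_def)
qed

section \<open>Derivations and the involution\<close>

lemma
  assumes "derivation scale d"
  shows derivation_add: "d (a + b) = d a + d b"
    and derivation_scale: "d (scale c a) = scale c (d a)"
    and derivation_mult: "d (a * b) = d a * b + a * d b"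
  using assms by (auto simp: derivation_def linear_iff_module_hom module_hom_iff)

lemma derivation_zero:
  assumes "derivation scale d"
  shows "d 0 = 0"
  using derivation_add[OF assms, of 0 0] by simp

context complex_star_algebra
begin

lemma scale_one_mult [simp]: "scale c 1 * a = scale c a"
  by (simp add: scale_mult_left)

lemma mult_scale_one [simp]: "a * scale c 1 = scale c a"
  by (simp add: scale_mult_right)

lemma star_one [simp]: "star 1 = 1"
  by (metis mult_1 star_mult star_star mult_1_right)

lemma star_diff: "star (a - b) = star a - star b"
  using star_add[of "a - b" b] by (simp add: algebra_simps)

lemma star_deriv_star [simp]: "star_deriv star d (star a) = star (d a)"
  by (simp add: star_deriv_def star_star)

lemma star_deriv_star_deriv [simp]: "star_deriv star (star_deriv star d) = d"
  by (simp add: star_deriv_def star_star)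

text \<open>The conjugated coefficients will match those produced by the conjugate linear first
  argument of \<open>h\<close>, which makes the adjoint of a connection complex linear in the
  derivation.\<close>

lemma star_deriv_lincomb:
  "star_deriv star (\<lambda>f. scale c (d f) + scale c' (e f)) =
     (\<lambda>f. scale (cnj c) (star_deriv star d f) + scale (cnj c') (star_deriv star e f))"
  by (simp add: star_deriv_def star_add star_scale)

end

section \<open>Connections on retracts of free modules\<close>

context lie_pair
begin

lemma lincomb_closed:
  assumes "d \<in> \<gg>" "e \<in> \<gg>"
  shows "(\<lambda>f. scale c (d f) + scale c' (e f)) \<in> \<gg>"
  using add_closed[OF scale_closed scale_closed] assms .

text \<open>Coordinatewise differentiation satisfies the connection laws on the free module, and
  \<open>\<psi>\<close> carries them to \<open>M\<close>. In the Leibniz rule,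
  \<open>\<psi> (\<phi> m) = m\<close> turns the derivative term into
  \<open>act m (d a)\<close>.\<close>

lemma connection_retract_of_free:
  fixes act :: "'m::ab_group_add \<Rightarrow> 'a \<Rightarrow> 'm" and \<phi> :: "'m \<Rightarrow> ('i \<Rightarrow>\<^sub>0 'a)"
  assumes \<phi>: "right_module_hom act free_act \<phi>" and \<psi>: "right_module_hom free_act act \<psi>"
    and \<psi>\<phi>: "\<And>m. \<psi> (\<phi> m) = m"
  shows "connection scale \<gg> act (\<lambda>d m. \<psi> (Poly_Mapping.map d (\<phi> m)))"
proof -
  \<comment> \<open>\<open>Poly_Mapping.map d\<close> keeps zero coefficients at 0 whatever
    \<open>d\<close> is; this agrees with applying \<open>d\<close> because
    \<open>d 0 = 0\<close>.\<close>
  have lookup: "Poly_Mapping.lookup (Poly_Mapping.map d f) i = d (Poly_Mapping.lookup f i)"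
    if "d \<in> \<gg>" for d and f :: "'i \<Rightarrow>\<^sub>0 'a" and i
    using derivation_zero[OF derivations[OF that]] by (simp add: map.rep_eq when_def)
  have \<phi>_add: "\<phi> (m + n) = \<phi> m + \<phi> n" and \<phi>_act: "\<phi> (act m a) = free_act (\<phi> m) a" for m n a
    using \<phi> by (auto simp: right_module_hom_def)
  have \<psi>_add: "\<psi> (f + g) = \<psi> f + \<psi> g" and \<psi>_act: "\<psi> (free_act f a) = act (\<psi> f) a" for f g a
    using \<psi> by (auto simp: right_module_hom_def)
  have "Poly_Mapping.map d (f + g) = Poly_Mapping.map d f + Poly_Mapping.map d g"
    if "d \<in> \<gg>" for d and f g :: "'i \<Rightarrow>\<^sub>0 'a"
    using that by (intro poly_mapping_eqI)
      (simp add: lookup lookup_add derivation_add[OF derivations])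
  \<comment> \<open>Scalars are written as the action of \<open>scale c 1\<close>, so that
    \<open>\<psi>\<close> maps them to \<open>module_scale\<close>.\<close>
  moreover have "Poly_Mapping.map (\<lambda>f. scale c (d f) + scale c' (e f)) f =
      free_act (Poly_Mapping.map d f) (scale c 1) + free_act (Poly_Mapping.map e f) (scale c' 1)"
    if "d \<in> \<gg>" "e \<in> \<gg>" for d e c c' and f :: "'i \<Rightarrow>\<^sub>0 'a"
    using that by (intro poly_mapping_eqI) (simp add: lookup lookup_add lincomb_closed)
  moreover have "Poly_Mapping.map d (free_act f a) =
      free_act (Poly_Mapping.map d f) a + free_act f (d a)"
    if "d \<in> \<gg>" for d a and f :: "'i \<Rightarrow>\<^sub>0 'a"
    using that by (intro poly_mapping_eqI)
      (simp add: lookup lookup_add derivation_mult[OF derivations])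
  ultimately show ?thesis
    by (simp add: connection_def module_scale_def \<phi>_add \<phi>_act \<psi>_add \<psi>_act \<psi>\<phi>)
qed

end

section \<open>Connections in the presence of an invertible hermitian form\<close>

locale regular_hermitian = lie_pair scale star \<gg> + right_module act
  for scale :: "complex \<Rightarrow> 'a::{ring, monoid_mult} \<Rightarrow> 'a" and star and \<gg>
    and act :: "'m::ab_group_add \<Rightarrow> 'a \<Rightarrow> 'm" +
  fixes h :: "'m \<Rightarrow> 'm \<Rightarrow> 'a"
  assumes hermitian: "hermitian_form star act h"
    and invertible: "invertible_form act h"
begin

lemma star_h: "star (h m n) = h n m"
  and h_act_right: "h m (act n a) = h m n * a"
  and h_add_left: "h (m + n) k = h m k + h n k"
  using hermitian by (auto simp: hermitian_form_def)

lemma h_add_right: "h k (m + n) = h k m + h k n"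
  by (metis star_h star_add h_add_left)

lemma h_act_left: "h (act m a) n = star a * h m n"
  by (metis star_h star_mult h_act_right)

lemma h_module_scale_left: "h (module_scale scale act c m) n = scale (cnj c) (h m n)"
  by (simp add: module_scale_def h_act_left star_scale)

lemma h_module_scale_right: "h m (module_scale scale act c n) = scale c (h m n)"
  by (simp add: module_scale_def h_act_right)

text \<open>Injectivity of \<open>h\<close> into the dual reduces equations in the module to
  equations in the algebra; the connection laws below are checked this way.\<close>

lemma h_eqI:
  assumes "\<And>n. h m n = h m' n"
  shows "m = m'"
proof (rule injD)
  show "inj h"
    using invertible by (simp add: invertible_form_def bij_betw_def)
qed (use assms in auto)

text \<open>Surjectivity of \<open>h\<close> onto the dual: a Riesz representation, from which the
  adjoint connection is built.\<close>

lemma h_represents: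
  assumes "right_module_hom act (*) \<omega>"
  obtains m where "h m = \<omega>"
proof -
  have "\<omega> \<in> range h"
    using invertible assms by (simp add: invertible_form_def bij_betw_def dual_module_def)
  then show ?thesis
    using that by blast
qed

text \<open>The weights sum to 1, so the inhomogeneous Leibniz term survives exactly once.\<close>

lemma connection_mean:
  assumes nabla: "connection scale \<gg> act nabla" and nabla': "connection scale \<gg> act nabla'"
  shows "connection scale \<gg> act (\<lambda>d m. module_scale scale act (1/2) (nabla d m + nabla' d m))"
proof -
  have half: "scale (1/2) a + scale (1/2) a = a" for a
    by (simp flip: scale_left_distrib)
  show ?thesis
    unfolding connection_def
  proof (intro conjI ballI allI; rule h_eqI)
    fix d m n k assume d: "d \<in> \<gg>"
    show "h (module_scale scale act (1/2) (nabla d (m + n) + nabla' d (m + n))) k =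
        h (module_scale scale act (1/2) (nabla d m + nabla' d m) +
           module_scale scale act (1/2) (nabla d n + nabla' d n)) k"
      using nabla nabla' d
      by (simp add: connection_def h_module_scale_left h_add_left algebra_simps scale_right_distrib)
  next
    fix d e c c' m k assume d: "d \<in> \<gg>" and e: "e \<in> \<gg>"
    show "h (module_scale scale act (1/2) (nabla (\<lambda>f. scale c (d f) + scale c' (e f)) m +
          nabla' (\<lambda>f. scale c (d f) + scale c' (e f)) m)) k =
        h (module_scale scale act c (module_scale scale act (1/2) (nabla d m + nabla' d m)) +
           module_scale scale act c' (module_scale scale act (1/2) (nabla e m + nabla' e m))) k"
      using nabla nabla' d e
      by (simp add: connection_def h_module_scale_left h_add_left algebra_simps scale_right_distrib)
  next
    fix d m a k assume d: "d \<in> \<gg>"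
    \<comment> \<open>Here \<open>y\<close> stands for the Leibniz term
      \<open>star (d a) * h m k\<close>, contributed once by each connection.\<close>
    have "scale (1/2) (x + y + (z + y)) = scale (1/2) (x + z) + y" for x y z
      using half[of y] by (simp add: scale_right_distrib algebra_simps)
    then show "h (module_scale scale act (1/2) (nabla d (act m a) + nabla' d (act m a))) k =
        h (act (module_scale scale act (1/2) (nabla d m + nabla' d m)) a + act m (d a)) k"
      using nabla nabla' d
      by (simp add: connection_def h_module_scale_left h_add_left h_act_left scale_mult_right
          flip: distrib_left)
  qed
qed

text \<open>The right-hand side is a functional of \<open>n\<close>, linear over the algebra, so
  invertibility of \<open>h\<close> provides the vector \<open>nabla' d m\<close> representing
  it.\<close>

lemma adjoint_connection:
  assumes nabla: "connection scale \<gg> act nabla"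
  obtains nabla' where "connection scale \<gg> act nabla'"
    "\<And>d m n. d \<in> \<gg> \<Longrightarrow>
       h (nabla' d m) n = star_deriv star d (h m n) - h m (nabla (star_deriv star d) n)"
proof -
  have nabla_add: "nabla d (m + n) = nabla d m + nabla d n"
    and nabla_act: "nabla d (act m a) = act (nabla d m) a + act m (d a)"
    if "d \<in> \<gg>" for d m n a
    using nabla that by (auto simp: connection_def)
  have "\<exists>x. h x = (\<lambda>n. d (h m n) - h m (nabla d n))" if d: "d \<in> \<gg>" for d m
  proof -
    \<comment> \<open>Replacing \<open>n\<close> by \<open>act n a\<close>, both terms produce
      \<open>h m n * d a\<close>, and these cancel.\<close>
    have "right_module_hom act (*) (\<lambda>n. d (h m n) - h m (nabla d n))"
      using d by (simp add: right_module_hom_def nabla_add nabla_act h_add_right h_act_right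
          derivation_add[OF derivations] derivation_mult[OF derivations] algebra_simps)
    then show ?thesis
      using h_represents by metis
  qed
  \<comment> \<open>The representation is used at \<open>star_deriv star d\<close>. Membership in
    \<open>\<gg>\<close> moves under the quantifiers so that choice yields a total function.\<close>
  then have "\<forall>d m. \<exists>x. d \<in> \<gg> \<longrightarrow>
      (\<forall>n. h x n = star_deriv star d (h m n) - h m (nabla (star_deriv star d) n))"
    using star_closed by metis
  then obtain nabla' where nabla': "d \<in> \<gg> \<Longrightarrow>
      h (nabla' d m) n = star_deriv star d (h m n) - h m (nabla (star_deriv star d) n)" for d m n
    by metis
  have "connection scale \<gg> act nabla'"
    unfolding connection_def
  proof (intro conjI ballI allI; rule h_eqI)
    fix d m n k assume "d \<in> \<gg>"
    then show "h (nabla' d (m + n)) k = h (nabla' d m + nabla' d n) k"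
      by (simp add: nabla' h_add_left derivation_add[OF derivations[OF star_closed]])
  next
    fix d e c c' m k assume "d \<in> \<gg>" "e \<in> \<gg>"
    then show "h (nabla' (\<lambda>f. scale c (d f) + scale c' (e f)) m) k =
        h (module_scale scale act c (nabla' d m) + module_scale scale act c' (nabla' e m)) k"
      using nabla star_closed
      by (simp add: nabla' lincomb_closed connection_def star_deriv_lincomb h_add_left h_add_right
          h_module_scale_left h_module_scale_right scale_right_diff_distrib)
  next
    fix d m a k assume "d \<in> \<gg>"
    \<comment> \<open>As \<open>h (act m a) k = star a * h m k\<close>, the Leibniz term is
      \<open>star_deriv star d (star a)\<close>, which is \<open>star (d a)\<close>, times
      \<open>h m k\<close>.\<close>
    then show "h (nabla' d (act m a)) k = h (act (nabla' d m) a + act m (d a)) k"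
      by (simp add: nabla' h_add_left h_act_left derivation_mult[OF derivations[OF star_closed]]
          algebra_simps)
  qed
  then show ?thesis
    using nabla' that by blast
qed

text \<open>The adjoint relation is used twice, directly and after applying \<open>star\<close>; the
  average of the two identities is the hermitian condition for the mean.\<close>

lemma hermitian_connection_exists:
  assumes nabla: "connection scale \<gg> act nabla"
  shows "\<exists>nabla'. hermitian_connection scale star \<gg> act h nabla'"
proof -
  obtain nabla' where conn: "connection scale \<gg> act nabla'"
    and nabla': "d \<in> \<gg> \<Longrightarrow>
      h (nabla' d m) n = star_deriv star d (h m n) - h m (nabla (star_deriv star d) n)" for d m n
    using adjoint_connection[OF nabla] by blast
  have "d (h m n) =
      h (module_scale scale act (1/2)
          (nabla (star_deriv star d) m + nabla' (star_deriv star d) m)) n +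
      h m (module_scale scale act (1/2) (nabla d n + nabla' d n))" if d: "d \<in> \<gg>" for d m n
  proof -
    \<comment> \<open>Swapping the arguments and applying \<open>star\<close> moves
      \<open>nabla'\<close> to the second slot.\<close>
    have "h m (nabla' d n) = star (star_deriv star d (h n m) - h n (nabla (star_deriv star d) m))"
      using d by (metis nabla' star_h)
    also have "\<dots> = d (h m n) - h (nabla (star_deriv star d) m) n"
      by (simp add: star_diff star_h star_deriv_def star_star)
    \<comment> \<open>The relation at \<open>star_deriv star d\<close> treats the term with
      \<open>nabla'\<close> in the first slot; in the sum all terms containing \<open>nabla\<close>
      cancel.\<close>
    finally have "h (nabla (star_deriv star d) m + nabla' (star_deriv star d) m) n +
        h m (nabla d n + nabla' d n) = d (h m n) + d (h m n)"
      using d by (simp add: nabla' star_closed h_add_left h_add_right)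
    then show ?thesis
      by (simp add: h_module_scale_left h_module_scale_right
          flip: scale_right_distrib)
        (simp add: scale_right_distrib flip: scale_left_distrib)
  qed
  then show ?thesis
    using connection_mean[OF nabla conn] unfolding hermitian_connection_def by blast
qed

end

theorem corollary3p7:
  fixes scale :: "complex \<Rightarrow> 'a::{ring, monoid_mult} \<Rightarrow> 'a"
    and star :: "'a \<Rightarrow> 'a"
    and \<gg> :: "('a \<Rightarrow> 'a) set"
    and act :: "'m::ab_group_add \<Rightarrow> 'a \<Rightarrow> 'm"
    and h :: "'m \<Rightarrow> 'm \<Rightarrow> 'a"
  assumes "lie_pair scale star \<gg>"
    and "regular_hermitian_module star act h"
  shows "\<exists>nabla. hermitian_connection scale star \<gg> act h nabla"
proof -
  interpret lie_pair scale star \<gg>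
    by fact
  interpret regular_hermitian scale star \<gg> act h
    using assms(2) by (auto simp: regular_hermitian_module_def regular_hermitian_axioms_def
        intro!: regular_hermitian.intro assms(1))
  have "projective act"
    using assms(2) by (simp add: regular_hermitian_module_def)
  then show ?thesis
    using projective_retract_of_free connection_retract_of_free hermitian_connection_exists by metis
qed

end
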